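(* Let $G$ be a graph or digraph and let $A=(A,\alpha)$ and $B=(B,\beta)$ be dacards of $G$ obtained by deleting distinct vertices of $G$. Let $P_1,P_2$ be two dapastings of $A$ and $B$ as members of $\mathrm{Dadeck}(G)$, and let $CP_1$, $CP_2$ be completions of $P_1$, $P_2$ obtained by adding arcs between the respective external vertices. There is an isomorphism from $CP_1$ to $CP_2$ mapping the set of external vertices of $P_1$ onto the set of external vertices of $P_2$ if and only if $P_1$ and $P_2$ are isomorphic as dapastings.
   Context: Digraphs are finite, without loops or multiple arcs; a graph is regarded as a digraph in which every edge is a pair of opposite arcs. For a vertex $x$ of a digraph $D$, $\mathrm{dt}_D(x)=(a,b,c)$ where $a,b,c$ count vertices $w$ such that respectively only $xw$, only $wx$, both $xw,wx$ are arcs. A dacard of $D$ is a pair $(D-x,\mathrm{dt}_D(x))$, with $D-x$ up to isomorphism; $\mathrm{Dadeck}(D)$ is the multiset of dacards; digraphs with the same dadeck are da-hypomorphs. Dapasting: a dapasting of dacards $(A,\alpha),(B,\beta)$ of $G$ (from distinct vertices) as members of $\mathrm{Dadeck}(G)$ is a digraph $P$ with two distinct non-adjacent vertices $u,v$ (external vertices), $u$ labeled $(e,\alpha)$, $v$ labeled $(e,\beta)$, other vertices unlabeled, such that $P-u\cong A$, $P-v\cong B$ and there is $Y\in\{P,P+uv,P+vu,P+uv+vu\}$ ($P+xy$ = $P$ with arc $xy$ added) with $\mathrm{dt}_Y(u)=\alpha$, $\mathrm{dt}_Y(v)=\beta$ and $Y$ da-hypomorphic to $G$; such $Y$ (and any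 digraph isomorphic to it) is a completion of $P$. Two dapastings are isomorphic if there is a digraph isomorphism between them mapping each vertex to a vertex with the same label (unlabeled to unlabeled). *)

theory Defs
  imports "Graph_Theory.Graph_Theory" "HOL-Library.Multiset"
begin

text \<open>
  Digraphs (finite, no loops, no multiple arcs) are those satisfying the locale \<^locale>\<open>digraph\<close>;
  graphs are the symmetric ones among them. Digraphs to which arcs are added are represented as
  pair digraphs, so that \<open>(u, v)\<close> is itself the arc from \<open>u\<close> to \<open>v\<close>; they are turned into
  general digraphs by \<^const>\<open>with_proj\<close>.
\<close>

type_synonym degree_triple = "nat \<times> nat \<times> nat"

definition dt :: "('a, 'b) pre_digraph \<Rightarrow> 'a \<Rightarrow> degree_triple" where
  "dt D x =
     (card {w \<in> verts D. (x, w) \<in> arcs_ends D \<and> (w, x) \<notin> arcs_ends D},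
      card {w \<in> verts D. (x, w) \<notin> arcs_ends D \<and> (w, x) \<in> arcs_ends D},
      card {w \<in> verts D. (x, w) \<in> arcs_ends D \<and> (w, x) \<in> arcs_ends D})"

text \<open>
  The isomorphism type of a digraph is the set of all its isomorphic copies with natural numbers
  as vertices. It is a complete isomorphism invariant for finite digraphs, see
  \<open>iso_type_eq_iff\<close> below, and does not depend on the type of the vertices or arcs.
\<close>

type_synonym iso_type = "nat pair_pre_digraph set"

definition iso_type :: "('a, 'b) pre_digraph \<Rightarrow> iso_type" where
  "iso_type D = {H. digraph_iso D (with_proj H)}"

type_synonym dacard = "iso_type \<times> degree_triple"

definition dacard :: "('a, 'b) pre_digraph \<Rightarrow> 'a \<Rightarrow> dacard" where
  "dacard D x = (iso_type (pre_digraph.del_vert D x), dt D x)"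

definition dadeck :: "('a, 'b) pre_digraph \<Rightarrow> dacard multiset" where
  "dadeck D = image_mset (dacard D) (mset_set (verts D))"

definition da_hypomorphic :: "('a, 'b) pre_digraph \<Rightarrow> ('c, 'd) pre_digraph \<Rightarrow> bool" where
  "da_hypomorphic D E \<longleftrightarrow> digraph D \<and> digraph E \<and> dadeck D = dadeck E"

text \<open>
  The four digraphs that arise from \<open>P\<close> by adding any of the arcs \<open>uv\<close> and \<open>vu\<close>.
\<close>

definition arc_extensions ::
  "'a pair_pre_digraph \<Rightarrow> 'a \<Rightarrow> 'a \<Rightarrow> ('a, 'a \<times> 'a) pre_digraph set" where
  "arc_extensions P u v =
     {with_proj P,
      pre_digraph.add_arc (with_proj P) (u, v),
      pre_digraph.add_arc (with_proj P) (v, u),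
      pre_digraph.add_arc (pre_digraph.add_arc (with_proj P) (u, v)) (v, u)}"

text \<open>
  The completions of \<open>P\<close> obtained by adding arcs between its external vertices \<open>u\<close> (labelled
  \<open>(e, \<alpha>)\<close>) and \<open>v\<close> (labelled \<open>(e, \<beta>)\<close>), as opposed to mere isomorphic copies of these.
\<close>

definition arc_completion ::
  "('g, 'h) pre_digraph \<Rightarrow> degree_triple \<Rightarrow> degree_triple \<Rightarrow>
   'a pair_pre_digraph \<Rightarrow> 'a \<Rightarrow> 'a \<Rightarrow> ('a, 'a \<times> 'a) pre_digraph \<Rightarrow> bool" where
  "arc_completion G \<alpha> \<beta> P u v Y \<longleftrightarrow>
     Y \<in> arc_extensions P u v \<and> dt Y u = \<alpha> \<and> dt Y v = \<beta> \<and> da_hypomorphic Y G"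

text \<open>
  \<open>P\<close> with external vertices \<open>u\<close>, \<open>v\<close> is a dapasting of the given dacards as members of
  the dadeck of \<open>G\<close>. The labelling of a dapasting is determined by \<open>u\<close>, \<open>v\<close> and the two
  degree triples; it is given by \<open>ext_labels\<close>, where \<open>Some \<gamma>\<close> is the label \<open>(e, \<gamma>)\<close> of
  an external vertex and \<open>None\<close> stands for an unlabelled one.
\<close>

definition dapasting ::
  "('g, 'h) pre_digraph \<Rightarrow> dacard \<Rightarrow> dacard \<Rightarrow> 'a pair_pre_digraph \<Rightarrow> 'a \<Rightarrow> 'a \<Rightarrow> bool" where
  "dapasting G = (\<lambda>(A, \<alpha>) (B, \<beta>) P u v.
     pair_digraph P \<and> u \<in> pverts P \<and> v \<in> pverts P \<and> u \<noteq> v \<and>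
     (u, v) \<notin> parcs P \<and> (v, u) \<notin> parcs P \<and>
     iso_type (pre_digraph.del_vert (with_proj P) u) = A \<and>
     iso_type (pre_digraph.del_vert (with_proj P) v) = B \<and>
     (\<exists>Y. arc_completion G \<alpha> \<beta> P u v Y))"

definition ext_labels ::
  "degree_triple \<Rightarrow> degree_triple \<Rightarrow> 'a \<Rightarrow> 'a \<Rightarrow> 'a \<Rightarrow> degree_triple option" where
  "ext_labels \<alpha> \<beta> u v = [u \<mapsto> \<alpha>, v \<mapsto> \<beta>]"

definition isomorphism_between ::
  "('a, 'b) pre_digraph \<Rightarrow> ('c, 'd) pre_digraph \<Rightarrow> ('a, 'b, 'c, 'd) digraph_isomorphism \<Rightarrow> bool" where
  "isomorphism_between D E f \<longleftrightarrow> pre_digraph.digraph_isomorphism D f \<and> E = app_iso f D"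

definition labelled_iso ::
  "('a, 'b) pre_digraph \<Rightarrow> ('a \<Rightarrow> 'l option) \<Rightarrow> ('c, 'd) pre_digraph \<Rightarrow> ('c \<Rightarrow> 'l option) \<Rightarrow> bool" where
  "labelled_iso D l E m \<longleftrightarrow>
     (\<exists>f. isomorphism_between D E f \<and> (\<forall>w \<in> verts D. m (iso_verts f w) = l w))"

lemma digraph_iso_refl: "wf_digraph D \<Longrightarrow> digraph_iso D D"
  unfolding digraph_iso_def pre_digraph.digraph_isomorphism_def
  by (rule exI[of _ "\<lparr>iso_verts = id, iso_arcs = id, iso_head = head D, iso_tail = tail D\<rparr>"])
    (auto simp: app_iso_def)

lemma digraph_iso_sym:
  assumes "digraph_iso D E"
  shows "digraph_iso E D"
proof -
  have "wf_digraph D"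
    using assms by (auto simp: digraph_iso_def pre_digraph.digraph_isomorphism_def)
  then show ?thesis
    using assms wf_digraph.digraph_isomorphism_invI pre_digraph.app_iso_inv
    unfolding digraph_iso_def by metis
qed

lemma iso_type_nonempty:
  assumes "digraph D"
  shows "iso_type D \<noteq> {}"
proof -
  interpret digraph D by fact
  obtain g :: "'a \<Rightarrow> nat" where g: "inj_on g (verts D)"
    using finite_imp_inj_to_nat_seg[OF finite_verts] by blast
  define a where "a = (\<lambda>e. (g (tail D e), g (head D e)))"
  have a: "inj_on a (arcs D)"
    using g no_multi_arcs by (fastforce simp: a_def inj_on_def arc_to_ends_def)
  define f where "f = \<lparr>iso_verts = g, iso_arcs = a, iso_head = snd, iso_tail = fst\<rparr>"
  have "digraph_isomorphism f"
    using g a wf_digraph by (auto simp: digraph_isomorphism_def f_def a_def)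
  moreover have "app_iso f D = with_proj \<lparr>pverts = g ` verts D, parcs = a ` arcs D\<rparr>"
    by (simp add: app_iso_def with_proj_def f_def)
  ultimately show ?thesis
    unfolding iso_type_def digraph_iso_def by (metis (mono_tags, lifting) empty_iff mem_Collect_eq)
qed

lemma iso_type_eq_iff:
  assumes "digraph D" and "digraph E"
  shows "iso_type D = iso_type E \<longleftrightarrow> digraph_iso D E"
proof
  assume eq: "iso_type D = iso_type E"
  obtain H where H: "H \<in> iso_type D"
    using iso_type_nonempty[OF assms(1)] by blast
  then have "H \<in> iso_type E"
    by (simp only: eq)
  with H have "digraph_iso D (with_proj H)" "digraph_iso (with_proj H) E"
    by (simp_all add: iso_type_def digraph_iso_sym)
  then show "digraph_iso D E"
    by (rule digraph_iso_trans)
next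
  assume DE: "digraph_iso D E"
  show "iso_type D = iso_type E"
    using digraph_iso_trans[OF DE] digraph_iso_trans[OF digraph_iso_sym[OF DE]]
    by (auto simp: iso_type_def)
qed

end

theory Submission
  imports Defs
begin

text \<open>
  Deleting the arcs between the external vertices turns an isomorphism of completions into one of
  the dapastings. Conversely, \<open>u\<close> and \<open>v\<close> are not adjacent in a dapasting, so the difference
  between the degree triple of \<open>u\<close> in a completion and in the dapasting reveals which arcs
  between \<open>u\<close> and \<open>v\<close> were added; as degree triples are invariant, an isomorphism of dapastings
  carries the added arcs of one completion to those of the other. If an isomorphism of completions
  exchanges the roles of the external vertices, then invariance of the degree triple forces
  \<open>\<alpha> = \<beta>\<close>, so that the labels are preserved as well.
\<close>

text \<open>An arc of a pair digraph is its pair of ends, so a vertex map carries all the data of an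
  isomorphism: the arc map has to be \<open>map_prod h h\<close>.\<close>

definition pair_iso :: "('a \<Rightarrow> 'b) \<Rightarrow> 'a pair_pre_digraph \<Rightarrow> 'b pair_pre_digraph \<Rightarrow> bool" where
  "pair_iso h D E \<longleftrightarrow>
     inj_on h (pverts D) \<and> pverts E = h ` pverts D \<and> parcs E = map_prod h h ` parcs D"

text \<open>The predicate \<open>Q\<close> on vertex maps lets the same translation serve both sides
  of the theorem: the condition on the set of external vertices and the preservation of
  labels.\<close>

lemma ex_isomorphism_between_iff:
  assumes "pair_wf_digraph D"
  shows "(\<exists>f. isomorphism_between (with_proj D) (with_proj E) f \<and> Q (iso_verts f)) \<longleftrightarrow>
         (\<exists>h. pair_iso h D E \<and> Q h)"
proof
  interpret pair_wf_digraph D by fact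
  assume "\<exists>f. isomorphism_between (with_proj D) (with_proj E) f \<and> Q (iso_verts f)"
  then obtain f where f: "digraph_isomorphism f" "with_proj E = app_iso f D" "Q (iso_verts f)"
    by (auto simp: isomorphism_between_def)
  from f(2) have E: "pverts E = iso_verts f ` pverts D" "parcs E = iso_arcs f ` parcs D"
    "iso_head f = snd" "iso_tail f = fst"
    by (auto simp: app_iso_def with_proj_def)
  \<comment> \<open>In \<open>with_proj E\<close> tail and head are the projections, so
    compatibility of \<open>f\<close> with tails and heads fixes both components of the image
    arc.\<close>
  have "iso_arcs f a = map_prod (iso_verts f) (iso_verts f) a" if "a \<in> parcs D" for a
    using f(1) E that by (cases a) (auto simp: digraph_isomorphism_def prod_eq_iff)
  with f(1) E have "pair_iso (iso_verts f) D E"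
    by (simp add: pair_iso_def digraph_isomorphism_def)
  with f(3) show "\<exists>h. pair_iso h D E \<and> Q h" by blast
next
  interpret pair_wf_digraph D by fact
  assume "\<exists>h. pair_iso h D E \<and> Q h"
  then obtain h where h: "pair_iso h D E" "Q h" by blast
  define f where "f = \<lparr>iso_verts = h, iso_arcs = map_prod h h, iso_head = snd, iso_tail = fst\<rparr>"
  have "inj_on (map_prod h h) (pverts D \<times> pverts D)"
    using h(1) by (auto simp: pair_iso_def intro: map_prod_inj_on)
  then have "inj_on (map_prod h h) (parcs D)"
    by (rule inj_on_subset) (use in_arcsD1 in_arcsD2 in auto)
  then have "digraph_isomorphism f"
    using h(1) wf_digraph by (auto simp: digraph_isomorphism_def f_def pair_iso_def)
  moreover have "with_proj E = app_iso f D"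
    using h(1) by (simp add: app_iso_def with_proj_def f_def pair_iso_def)
  moreover have "Q (iso_verts f)"
    using h(2) by (simp add: f_def)
  ultimately show "\<exists>f. isomorphism_between (with_proj D) (with_proj E) f \<and> Q (iso_verts f)"
    by (auto simp: isomorphism_between_def)
qed

lemma pair_iso_arc_iff:
  assumes "pair_wf_digraph D" "pair_iso h D E" "x \<in> pverts D" "w \<in> pverts D"
  shows "(h x, h w) \<in> parcs E \<longleftrightarrow> (x, w) \<in> parcs D"
proof -
  interpret pair_wf_digraph D by fact
  have "inj_on (map_prod h h) (pverts D \<times> pverts D)"
    using assms(2) by (auto simp: pair_iso_def intro: map_prod_inj_on)
  moreover have "parcs D \<subseteq> pverts D \<times> pverts D"
    using in_arcsD1 in_arcsD2 by auto
  ultimately have "map_prod h h (x, w) \<in> map_prod h h ` parcs D \<longleftrightarrow> (x, w) \<in> parcs D"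
    using assms(3,4) by (intro inj_on_image_mem_iff) auto
  then show ?thesis
    using assms(2) by (simp add: pair_iso_def)
qed

lemma dt_with_proj:
  "dt (with_proj D) x =
     (card {w \<in> pverts D. (x, w) \<in> parcs D \<and> (w, x) \<notin> parcs D},
      card {w \<in> pverts D. (x, w) \<notin> parcs D \<and> (w, x) \<in> parcs D},
      card {w \<in> pverts D. (x, w) \<in> parcs D \<and> (w, x) \<in> parcs D})"
  by (simp add: dt_def arcs_ends_def arc_to_ends_def)

lemma dt_pair_iso:
  assumes "pair_wf_digraph D" "pair_iso h D E" "x \<in> pverts D"
  shows "dt (with_proj E) (h x) = dt (with_proj D) x"
proof -
  have inj: "inj_on h (pverts D)" and vE: "pverts E = h ` pverts D"
    using assms(2) by (auto simp: pair_iso_def)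
  \<comment> \<open>The Boolean function \<open>R\<close> stands for any of the three adjacency
    conditions counted by \<open>dt\<close>; \<open>h\<close> restricts to a bijection between the
    counted sets.\<close>
  have "card {w \<in> pverts E. R ((h x, w) \<in> parcs E) ((w, h x) \<in> parcs E)} =
        card {w \<in> pverts D. R ((x, w) \<in> parcs D) ((w, x) \<in> parcs D)}" for R
  proof -
    have "{w \<in> pverts E. R ((h x, w) \<in> parcs E) ((w, h x) \<in> parcs E)} =
          h ` {w \<in> pverts D. R ((x, w) \<in> parcs D) ((w, x) \<in> parcs D)}"
      using pair_iso_arc_iff[OF assms(1,2)] assms(3) vE by auto
    then show ?thesis
      by (simp add: card_image inj_on_subset[OF inj])
  qed
  from this[of "\<lambda>a b. a \<and> \<not> b"] this[of "\<lambda>a b. \<not> a \<and> b"] this[of "\<lambda>a b. a \<and> b"]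
  show ?thesis by (simp add: dt_with_proj)
qed

abbreviation add_arcs :: "'a pair_pre_digraph \<Rightarrow> ('a \<times> 'a) set \<Rightarrow> 'a pair_pre_digraph" where
  "add_arcs P S \<equiv> \<lparr>pverts = pverts P, parcs = parcs P \<union> S\<rparr>"

text \<open>Adding an arc also inserts its ends as vertices; both are present already, so only the
  arc set grows and a single set \<open>S\<close> covers all four extensions.\<close>

lemma arc_extensionsE:
  assumes "Y \<in> arc_extensions P u v" "u \<in> pverts P" "v \<in> pverts P"
  obtains S where "S \<subseteq> {(u, v), (v, u)}" "Y = with_proj (add_arcs P S)"
proof -
  have "Y \<in> (\<lambda>S. with_proj (add_arcs P S)) ` {{}, {(u, v)}, {(v, u)}, {(u, v), (v, u)}}"
    using assms
    by (auto simp: arc_extensions_def pre_digraph.add_arc_def with_proj_def insert_absorb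
        insert_commute)
  with that show thesis by blast
qed

text \<open>Only the status of \<open>v\<close> relative to \<open>u\<close> changes: uncounted in
  \<open>P\<close>, it enters at most one of the three counts, and \<open>S\<close> decides
  which.\<close>

lemma dt_add_arcs:
  assumes "finite (pverts P)" "v \<in> pverts P" "u \<noteq> v" "(u, v) \<notin> parcs P" "(v, u) \<notin> parcs P"
    and "S \<subseteq> {(u, v), (v, u)}" and "dt (with_proj P) u = (a, b, c)"
  shows "dt (with_proj (add_arcs P S)) u =
    (a + of_bool ((u, v) \<in> S \<and> (v, u) \<notin> S),
     b + of_bool ((u, v) \<notin> S \<and> (v, u) \<in> S),
     c + of_bool ((u, v) \<in> S \<and> (v, u) \<in> S))"
proof -
  have "card {w \<in> pverts P. R ((u, w) \<in> parcs P \<union> S) ((w, u) \<in> parcs P \<union> S)} =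
        card {w \<in> pverts P. R ((u, w) \<in> parcs P) ((w, u) \<in> parcs P)} +
        of_bool (R ((u, v) \<in> S) ((v, u) \<in> S))" if "\<not> R False False" for R
  proof -
    let ?A = "{w \<in> pverts P. R ((u, w) \<in> parcs P) ((w, u) \<in> parcs P)}"
    have "{w \<in> pverts P. R ((u, w) \<in> parcs P \<union> S) ((w, u) \<in> parcs P \<union> S)} =
          ?A \<union> (if R ((u, v) \<in> S) ((v, u) \<in> S) then {v} else {})" (is "?L = ?R")
    proof (rule set_eqI)
      fix w
      show "w \<in> ?L \<longleftrightarrow> w \<in> ?R"
      proof (cases "w = v")
        case True
        then show ?thesis using assms that by simp
      next
        case False
        then have "(u, w) \<notin> S" "(w, u) \<notin> S" using assms(3,6) by auto
        with False show ?thesis by simp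
      qed
    qed
    moreover have "v \<notin> ?A" "finite ?A" using assms that by auto
    ultimately show ?thesis by simp
  qed
  from this[of "\<lambda>a b. a \<and> \<not> b"] this[of "\<lambda>a b. \<not> a \<and> b"] this[of "\<lambda>a b. a \<and> b"]
  show ?thesis using assms(7) by (simp add: dt_with_proj)
qed

text \<open>The vertices of \<open>Q\<close> are written as \<open>h u\<close> and
  \<open>h v\<close>, so the lemma applies whether \<open>h\<close> keeps or exchanges the roles of
  the external vertices. The triple at \<open>u\<close> alone suffices, since it determines
  \<open>S\<close>.\<close>

lemma pair_iso_add_arcs_iff:
  assumes P: "pair_fin_digraph P" "u \<in> pverts P" "v \<in> pverts P" "u \<noteq> v"
      "(u, v) \<notin> parcs P" "(v, u) \<notin> parcs P" "S \<subseteq> {(u, v), (v, u)}"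
    and Q: "pair_fin_digraph Q" "h u \<in> pverts Q" "h v \<in> pverts Q" "h u \<noteq> h v"
      "(h u, h v) \<notin> parcs Q" "(h v, h u) \<notin> parcs Q" "T \<subseteq> {(h u, h v), (h v, h u)}"
  shows "pair_iso h (add_arcs P S) (add_arcs Q T) \<longleftrightarrow>
    pair_iso h P Q \<and> dt (with_proj (add_arcs P S)) u = dt (with_proj (add_arcs Q T)) (h u)"
    (is "?L \<longleftrightarrow> ?R")
proof
  interpret P: pair_fin_digraph P by fact
  have wf: "pair_wf_digraph (add_arcs P S)"
    using P(2,3,7) P.in_arcsD1 P.in_arcsD2 by unfold_locales auto
  assume L: ?L
  have "parcs P = parcs (add_arcs P S) - {(u, v), (v, u)}" using P(5-7) by auto
  moreover have "parcs Q = parcs (add_arcs Q T) - {(h u, h v), (h v, h u)}" using Q(5-7) by auto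
  \<comment> \<open>Image commutes with difference because \<open>map_prod h h\<close> is injective
    on all pairs of vertices, which include the removed pairs.\<close>
  moreover have "map_prod h h ` (parcs (add_arcs P S) - {(u, v), (v, u)}) =
    map_prod h h ` parcs (add_arcs P S) - map_prod h h ` {(u, v), (v, u)}"
    by (rule inj_on_image_set_diff[of _ "pverts P \<times> pverts P"])
      (use L P(2,3,7) P.in_arcsD1 P.in_arcsD2 in
        \<open>auto simp: pair_iso_def intro: map_prod_inj_on\<close>)
  ultimately have "pair_iso h P Q"
    using L unfolding pair_iso_def by auto
  then show ?R
    using dt_pair_iso[OF wf L] P(2) by simp
next
  interpret P: pair_fin_digraph P by fact
  interpret Q: pair_fin_digraph Q by fact
  assume R: ?R
  obtain a b c where dt: "dt (with_proj P) u = (a, b, c)" by (metis prod_cases3)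
  then have "dt (with_proj Q) (h u) = (a, b, c)"
    using R P(2) dt_pair_iso P.pair_wf_digraph_axioms by metis
  \<comment> \<open>Both base triples are \<open>(a, b, c)\<close>, so the increments agree, and the
    four possible arc sets give four different increments.\<close>
  with R dt have "(u, v) \<in> S \<longleftrightarrow> (h u, h v) \<in> T" "(v, u) \<in> S \<longleftrightarrow> (h v, h u) \<in> T"
    using dt_add_arcs[OF _ P(3-7)] dt_add_arcs[OF _ Q(3-7)] P.pair_finite_verts Q.pair_finite_verts
    by (auto split: if_splits simp: of_bool_def)
  with P(7) Q(7) have "T = map_prod h h ` S"
    by (auto simp: image_iff)
  with R show ?L
    by (simp add: pair_iso_def image_Un)
qed

lemma ext_labels_preserved_iff:
  assumes "inj_on h V" "h ` V = W" "u1 \<in> V" "v1 \<in> V" "u1 \<noteq> v1" "u2 \<in> W" "v2 \<in> W" "u2 \<noteq> v2"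
  shows "(\<forall>w \<in> V. ext_labels \<alpha> \<beta> u2 v2 (h w) = ext_labels \<alpha> \<beta> u1 v1 w) \<longleftrightarrow>
    h u1 = u2 \<and> h v1 = v2 \<or> h u1 = v2 \<and> h v1 = u2 \<and> \<alpha> = \<beta>" (is "?L \<longleftrightarrow> ?R")
proof
  assume ?L
  \<comment> \<open>The labels at \<open>u1\<close> and \<open>v1\<close> force their images into
    \<open>{u2, v2}\<close>; if \<alpha> = \<beta>, only injectivity prevents both from landing on
    the same vertex.\<close>
  from this[rule_format, OF assms(3)] this[rule_format, OF assms(4)] show ?R
    using assms(5,8) inj_onD[OF assms(1) _ assms(3,4)]
    by (auto simp: ext_labels_def split: if_splits)
next
  assume ?R
  with assms inj_on_eq_iff[OF assms(1)] show ?L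
    by (auto simp: ext_labels_def)
qed

theorem theorem5p2:
  fixes G :: "('g, 'h) pre_digraph"
    and P1 :: "'a pair_pre_digraph"
    and P2 :: "'b pair_pre_digraph"
    and CP1 :: "('a, 'a \<times> 'a) pre_digraph"
    and CP2 :: "('b, 'b \<times> 'b) pre_digraph"
    and A B :: iso_type
    and \<alpha> \<beta> :: degree_triple
  assumes "digraph G"
    and "x \<in> verts G" and "y \<in> verts G" and "x \<noteq> y"
    and "(A, \<alpha>) = dacard G x" and "(B, \<beta>) = dacard G y"
    and "dapasting G (A, \<alpha>) (B, \<beta>) P1 u1 v1"
    and "dapasting G (A, \<alpha>) (B, \<beta>) P2 u2 v2"
    and "arc_completion G \<alpha> \<beta> P1 u1 v1 CP1"
    and "arc_completion G \<alpha> \<beta> P2 u2 v2 CP2"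
  shows "(\<exists>f. isomorphism_between CP1 CP2 f \<and> iso_verts f ` {u1, v1} = {u2, v2}) \<longleftrightarrow>
         labelled_iso (with_proj P1) (ext_labels \<alpha> \<beta> u1 v1)
                      (with_proj P2) (ext_labels \<alpha> \<beta> u2 v2)"
proof -
  have P1: "pair_digraph P1" "u1 \<in> pverts P1" "v1 \<in> pverts P1" "u1 \<noteq> v1"
      "(u1, v1) \<notin> parcs P1" "(v1, u1) \<notin> parcs P1"
    and P2: "pair_digraph P2" "u2 \<in> pverts P2" "v2 \<in> pverts P2" "u2 \<noteq> v2"
      "(u2, v2) \<notin> parcs P2" "(v2, u2) \<notin> parcs P2"
    using assms(7,8) by (auto simp: dapasting_def)
  interpret P1: pair_digraph P1 by fact
  interpret P2: pair_digraph P2 by fact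
  obtain S1 where S1: "S1 \<subseteq> {(u1, v1), (v1, u1)}" "CP1 = with_proj (add_arcs P1 S1)"
    using assms(9) arc_extensionsE P1(2,3) unfolding arc_completion_def by metis
  obtain S2 where S2: "S2 \<subseteq> {(u2, v2), (v2, u2)}" "CP2 = with_proj (add_arcs P2 S2)"
    using assms(10) arc_extensionsE P2(2,3) unfolding arc_completion_def by metis
  have dt: "dt CP1 u1 = \<alpha>" "dt CP1 v1 = \<beta>" "dt CP2 u2 = \<alpha>" "dt CP2 v2 = \<beta>"
    using assms(9,10) by (auto simp: arc_completion_def)
  have wf: "pair_wf_digraph (add_arcs P1 S1)"
    using S1(1) P1(2,3) P1.in_arcsD1 P1.in_arcsD2 by unfold_locales auto
  \<comment> \<open>Here the condition on degree triples reads \<alpha> = \<alpha> and disappears;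
    in the crossed case it compares \<open>u1\<close> with \<open>v2\<close> and becomes \<alpha> =
    \<beta>.\<close>
  have straight: "pair_iso h (add_arcs P1 S1) (add_arcs P2 S2) \<longleftrightarrow> pair_iso h P1 P2"
    if "h u1 = u2" "h v1 = v2" for h
    using pair_iso_add_arcs_iff[OF P1.pair_fin_digraph_axioms P1(2-6) S1(1)
        P2.pair_fin_digraph_axioms, of h S2] that P2 S2 S1 dt by simp
  have crossed: "pair_iso h (add_arcs P1 S1) (add_arcs P2 S2) \<longleftrightarrow> pair_iso h P1 P2 \<and> \<alpha> = \<beta>"
    if "h u1 = v2" "h v1 = u2" for h
    using pair_iso_add_arcs_iff[OF P1.pair_fin_digraph_axioms P1(2-6) S1(1)
        P2.pair_fin_digraph_axioms, of h S2] that P2 S2 S1 dt by (simp add: insert_commute)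
  have image: "h ` {u1, v1} = {u2, v2} \<longleftrightarrow> h u1 = u2 \<and> h v1 = v2 \<or> h u1 = v2 \<and> h v1 = u2"
    for h :: "'a \<Rightarrow> 'b"
    using P2(4) by (auto simp: doubleton_eq_iff)
  have labels: "(\<forall>w \<in> pverts P1. ext_labels \<alpha> \<beta> u2 v2 (h w) = ext_labels \<alpha> \<beta> u1 v1 w) \<longleftrightarrow>
      h u1 = u2 \<and> h v1 = v2 \<or> h u1 = v2 \<and> h v1 = u2 \<and> \<alpha> = \<beta>" if "pair_iso h P1 P2" for h
    using that P1 P2 by (intro ext_labels_preserved_iff) (auto simp: pair_iso_def)
  have "(\<exists>f. isomorphism_between CP1 CP2 f \<and> iso_verts f ` {u1, v1} = {u2, v2}) \<longleftrightarrow>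
        (\<exists>h. pair_iso h (add_arcs P1 S1) (add_arcs P2 S2) \<and> h ` {u1, v1} = {u2, v2})"
    unfolding S1(2) S2(2) by (rule ex_isomorphism_between_iff[OF wf])
  \<comment> \<open>The same \<open>h\<close> works on both sides: each says that \<open>h\<close>
    is an isomorphism from \<open>P1\<close> to \<open>P2\<close> that is either straight, or
    crossed with \<alpha> = \<beta>.\<close>
  also have "\<dots> \<longleftrightarrow> (\<exists>h. pair_iso h P1 P2 \<and>
      (\<forall>w \<in> pverts P1. ext_labels \<alpha> \<beta> u2 v2 (h w) = ext_labels \<alpha> \<beta> u1 v1 w))"
    using straight crossed image labels by metis
  also have "\<dots> \<longleftrightarrow> labelled_iso (with_proj P1) (ext_labels \<alpha> \<beta> u1 v1)
      (with_proj P2) (ext_labels \<alpha> \<beta> u2 v2)"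
    unfolding labelled_iso_def with_proj_simps
    by (rule ex_isomorphism_between_iff[OF P1.pair_wf_digraph_axioms, symmetric])
  finally show ?thesis .
qed

end
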